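(* Let $\xi\in L^\infty(D)$ be a complex scalar field written as $\xi(\mathbf{x})=|\xi(\mathbf{x})|\,e^{i\varphi_\xi(\mathbf{x})}$ with $\varphi_\xi(\mathbf{x})\in[\varphi_-,\varphi_+]\subset\mathbb{R}$ for almost every $\mathbf{x}\in D$. Assume that $\inf_{\mathbf{x}\in D}|\xi(\mathbf{x})|>0$, that $\varphi_+-\varphi_-<\pi$, and that $\varphi_-=\min_{\mathbf{x}\in D}\varphi_\xi(\mathbf{x})$ and $\varphi_+=\max_{\mathbf{x}\in D}\varphi_\xi(\mathbf{x})$. Then there is no ellipticity direction of $\xi$ outside the set $$\bigcup_{n\in\mathbb{Z}}\,\big]2n\pi-\pi/2-\varphi_-,\ 2n\pi+\pi/2-\varphi_+\big[.$$
   Context: $D$ is a bounded subset of $\mathbb{R}^3$, and $L^\infty(D)$ is the space of Lebesgue-measurable, essentially bounded complex scalar fields on $D$. An ellipticity direction of a complex scalar field $\xi=|\xi|e^{i\varphi_\xi}\in L^\infty(D)$ ($\varphi_\xi$ real-valued) is an angle $\theta_\xi\in\mathbb{R}$ for which there exists $\xi_->0$ such that $|\xi(\mathbf{x})|\cos(\theta_\xi+\varphi_\xi(\mathbf{x}))\ge\xi_-$ for almost every $\mathbf{x}\in D$. Here $i$ is the imaginary unit and open intervals are written $]a,b[$.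
   Formalization: The minimum and maximum of the phase over D (and the infimum of |ξ|) are taken in the essential sense, ignoring null sets; with pointwise extrema the claim fails, for example if the phase is 0 except at one point where it is 1. *)

theory Defs
  imports "HOL-Probability.Essential_Supremum"
begin

text \<open>
  Elements of \<open>L\<^sup>\<infinity>(D)\<close> are determined up to null sets only, so bounds on
  such a field, or on its phase, over \<open>D\<close> are essential bounds with respect to
  \<open>lebesgue_on D\<close>. On a null set \<open>D\<close> the essential infimum is \<open>\<infinity>\<close> and the
  essential supremum is \<open>-\<infinity>\<close>. As \<^const>\<open>esssup\<close> is \<open>\<infinity>\<close> on functions
  that are not measurable, the essential infimum of such a function is \<open>-\<infinity>\<close>.
\<close>

definition essinf :: "'a measure \<Rightarrow> ('a \<Rightarrow> ereal) \<Rightarrow> ereal" where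
  "essinf M f = - esssup M (\<lambda>x. - f x)"

definition L_infty :: "(real^3) set \<Rightarrow> (real^3 \<Rightarrow> complex) set" where
  "L_infty D = {\<xi> \<in> borel_measurable (lebesgue_on D).
     esssup (lebesgue_on D) (\<lambda>x. ereal (cmod (\<xi> x))) < \<infinity>}"

definition is_phase :: "(real^3) set \<Rightarrow> (real^3 \<Rightarrow> complex) \<Rightarrow> (real^3 \<Rightarrow> real) \<Rightarrow> bool" where
  "is_phase D \<xi> \<phi> \<longleftrightarrow>
     (AE x in lebesgue_on D. \<xi> x = complex_of_real (cmod (\<xi> x)) * exp (\<i> * complex_of_real (\<phi> x)))"

text \<open>
  The phase \<open>\<phi>\<close> used to write the field \<open>\<xi>\<close> is an explicit argument; the
  notion does not depend on its choice, because
  \<open>\<bar>\<xi>\<bar> cos (\<theta> + \<phi>) = Re (exp (\<i>\<theta>) \<xi>)\<close> almost everywhere.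
\<close>

definition ellipticity_direction ::
  "(real^3) set \<Rightarrow> (real^3 \<Rightarrow> complex) \<Rightarrow> (real^3 \<Rightarrow> real) \<Rightarrow> real \<Rightarrow> bool" where
  "ellipticity_direction D \<xi> \<phi> \<theta> \<longleftrightarrow>
     is_phase D \<xi> \<phi> \<and>
     (\<exists>\<xi>\<^sub>m>0. AE x in lebesgue_on D. cmod (\<xi> x) * cos (\<theta> + \<phi> x) \<ge> \<xi>\<^sub>m)"

end

theory Submission
  imports Defs
begin

text \<open>
  Since \<open>\<bar>\<xi>\<bar>\<close> is essentially bounded, an ellipticity direction \<open>\<theta>\<close> bounds
  \<open>cos (\<theta> + \<phi>)\<close> from below by some \<open>c > 0\<close> almost everywhere. The set of
  \<open>y\<close> with \<open>cos (\<theta> + y) \<ge> c\<close> is closed, so it contains the essential bounds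
  \<open>\<phi>\<^sub>m\<close> and \<open>\<phi>\<^sub>p\<close> of the phase. As these differ by less than \<open>\<pi>\<close>, the angles
  \<open>\<theta> + \<phi>\<^sub>m\<close> and \<open>\<theta> + \<phi>\<^sub>p\<close> lie in the same component of \<open>{t. cos t > 0}\<close>.
\<close>

text \<open>If a ball of radius \<open>e\<close> around \<open>a\<close> missed \<open>S\<close>,
  the bound \<open>f x \<le> a\<close> would sharpen to \<open>f x \<le> a - e\<close> almost
  everywhere, contradicting that \<open>a\<close> is the least essential upper bound.\<close>

lemma real_esssup_mem_closed:
  fixes f :: "'a \<Rightarrow> real"
  assumes "closed S" and "AE x in M. f x \<in> S"
    and eq: "esssup M (\<lambda>x. ereal (f x)) = ereal a"
  shows "a \<in> S"
proof -
  \<comment> \<open>A non-measurable function has \<open>esssup\<close> equal to \<infinity>, so a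
    finite value forces measurability.\<close>
  have meas: "(\<lambda>x. ereal (f x)) \<in> borel_measurable M"
    using eq esssup_non_measurable[of "\<lambda>x. ereal (f x)" M] by (auto simp: top_ereal_def)
  have le: "AE x in M. f x \<le> a"
    using esssup_AE[of "\<lambda>x. ereal (f x)" M] eq by simp
  have "\<exists>y\<in>S. dist y a < e" if "e > 0" for e
  proof (rule ccontr)
    assume far: "\<not> (\<exists>y\<in>S. dist y a < e)"
    have "AE x in M. ereal (f x) \<le> ereal (a - e)"
      using assms(2) le by eventually_elim (use far in \<open>force simp: dist_real_def\<close>)
    hence "esssup M (\<lambda>x. ereal (f x)) \<le> ereal (a - e)"
      by (rule esssup_I[OF meas])
    thus False using eq \<open>e > 0\<close> by simp
  qed
  hence "a \<in> closure S" by (simp add: closure_approachable)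
  thus ?thesis using \<open>closed S\<close> by simp
qed

lemma real_essinf_mem_closed:
  fixes f :: "'a \<Rightarrow> real"
  assumes "closed S" and "AE x in M. f x \<in> S"
    and "essinf M (\<lambda>x. ereal (f x)) = ereal a"
  shows "a \<in> S"
proof -
  have "esssup M (\<lambda>x. ereal (- f x)) = ereal (- a)"
    using assms(3) by (simp add: essinf_def ereal_uminus_eq_reorder)
  with real_esssup_mem_closed[of "uminus ` S" "\<lambda>x. - f x" M "- a"] assms(1,2)
  have "- a \<in> uminus ` S" by (simp add: closed_negations image_iff)
  thus ?thesis by auto
qed

lemma cos_nonpos:
  fixes t :: real
  assumes "pi / 2 \<le> t" and "t \<le> 3 * pi / 2"
  shows "cos t \<le> 0"
proof -
  have "cos (t - pi) \<ge> 0" using assms by (intro cos_ge_zero) auto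
  thus ?thesis by simp
qed

text \<open>Consecutive intervals of positivity of cos are separated by closed gaps of length pi,
  which a step shorter than pi cannot cross.\<close>

lemma cos_pos_same_component:
  fixes y z :: real
  assumes "cos y > 0" and "cos z > 0" and "y \<le> z" and "z - y < pi"
  obtains n :: int
  where "2 * of_int n * pi - pi / 2 < y" and "z < 2 * of_int n * pi + pi / 2"
proof -
  \<comment> \<open>Rounding \<open>y / (2 * pi)\<close> to a nearest integer puts
    \<open>y - k\<close> into [-pi, pi[.\<close>
  define n where "n = \<lfloor>y / (2 * pi) + 1 / 2\<rfloor>"
  define k where "k = 2 * of_int n * pi"
  have shift: "cos (t - k) = cos t" for t
    using cos_int_2pin[of n] sin_int_2pin[of n] by (simp add: k_def cos_diff mult_ac)
  have "of_int n \<le> y / (2 * pi) + 1 / 2" "y / (2 * pi) + 1 / 2 < of_int n + 1"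
    unfolding n_def by linarith+
  hence "k - pi \<le> y" "y < k + pi"
    unfolding k_def by (simp_all add: field_simps)
  have "k - pi / 2 < y"
  proof (rule ccontr)
    assume "\<not> ?thesis"
    hence "cos (- (y - k)) \<le> 0"
      using \<open>k - pi \<le> y\<close> pi_gt_zero by (intro cos_nonpos) linarith+
    thus False unfolding cos_minus shift using assms(1) by simp
  qed
  moreover have "y < k + pi / 2"
  proof (rule ccontr)
    assume "\<not> ?thesis"
    hence "cos (y - k) \<le> 0"
      using \<open>y < k + pi\<close> pi_gt_zero by (intro cos_nonpos) linarith+
    thus False unfolding shift using assms(1) by simp
  qed
  \<comment> \<open>Otherwise \<open>z - k\<close> would lie in the gap between pi/2 and 3 pi/2,
    since \<open>y - k\<close> is below pi/2 and \<open>z - y\<close> below pi.\<close>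
  moreover have "z < k + pi / 2"
  proof (rule ccontr)
    assume "\<not> ?thesis"
    hence "cos (z - k) \<le> 0"
      using \<open>y < k + pi / 2\<close> assms(4) by (intro cos_nonpos) linarith+
    thus False unfolding shift using assms(2) by simp
  qed
  ultimately show ?thesis using that[of n] by (simp add: k_def)
qed

lemma L_infty_bounded_AE:
  assumes "\<xi> \<in> L_infty D"
  obtains K where "K > 0" and "AE x in lebesgue_on D. cmod (\<xi> x) \<le> K"
proof -
  let ?s = "esssup (lebesgue_on D) (\<lambda>x. ereal (cmod (\<xi> x)))"
  obtain K where "?s \<le> ereal K"
    using assms by (cases ?s) (auto simp: L_infty_def)
  have "AE x in lebesgue_on D. ereal (cmod (\<xi> x)) \<le> ?s"
    by (rule esssup_AE)
  \<comment> \<open>The essential supremum may be 0, or -\<infinity> if \<open>D\<close> is null;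
    the maximum with 1 keeps the bound positive, so that one can divide by it.\<close>
  hence "AE x in lebesgue_on D. cmod (\<xi> x) \<le> max K 1"
  proof eventually_elim
    case (elim x)
    from order_trans[OF this \<open>?s \<le> ereal K\<close>] show ?case by simp
  qed
  thus ?thesis using that[of "max K 1"] by simp
qed

theorem proposition3p8:
  fixes D :: "(real^3) set"
    and \<xi> :: "real^3 \<Rightarrow> complex"
    and \<phi> :: "real^3 \<Rightarrow> real"
    and \<phi>\<^sub>m \<phi>\<^sub>p :: real
  assumes "bounded D"
    and "\<xi> \<in> L_infty D"
    and "is_phase D \<xi> \<phi>"
    and "AE x in lebesgue_on D. \<phi> x \<in> {\<phi>\<^sub>m..\<phi>\<^sub>p}"
    and "essinf (lebesgue_on D) (\<lambda>x. ereal (cmod (\<xi> x))) > 0"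
    and "\<phi>\<^sub>p - \<phi>\<^sub>m < pi"
    and "ereal \<phi>\<^sub>m = essinf (lebesgue_on D) (\<lambda>x. ereal (\<phi> x))"
    and "ereal \<phi>\<^sub>p = esssup (lebesgue_on D) (\<lambda>x. ereal (\<phi> x))"
  shows "\<not> (\<exists>\<theta>. ellipticity_direction D \<xi> \<phi> \<theta> \<and>
    \<theta> \<notin> (\<Union>n::int. {2 * of_int n * pi - pi / 2 - \<phi>\<^sub>m <..< 2 * of_int n * pi + pi / 2 - \<phi>\<^sub>p}))"
proof (intro notI, elim exE conjE)
  fix \<theta>
  assume "ellipticity_direction D \<xi> \<phi> \<theta>"
    and out: "\<theta> \<notin> (\<Union>n::int. {2 * of_int n * pi - pi / 2 - \<phi>\<^sub>m <..< 2 * of_int n * pi + pi / 2 - \<phi>\<^sub>p})"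
  then obtain c where "c > 0" and c: "AE x in lebesgue_on D. cmod (\<xi> x) * cos (\<theta> + \<phi> x) \<ge> c"
    by (auto simp: ellipticity_direction_def)
  obtain K where "K > 0" and K: "AE x in lebesgue_on D. cmod (\<xi> x) \<le> K"
    using L_infty_bounded_AE[OF assms(2)] .
  \<comment> \<open>The uniform bound \<open>c / K\<close> matters: {cos > 0} is open, and its limit
    points may have cosine 0.\<close>
  define S where "S = {y. c / K \<le> cos (\<theta> + y)}"
  have "closed S"
    unfolding S_def by (intro closed_Collect_le continuous_intros)
  have in_S: "AE x in lebesgue_on D. \<phi> x \<in> S"
    using c K
  proof eventually_elim
    case (elim x)
    \<comment> \<open>The sign is needed before the modulus can be replaced by its upper bound
      \<open>K\<close>.\<close>
    have "cos (\<theta> + \<phi> x) \<ge> 0"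
      using elim(1) \<open>c > 0\<close> by (smt (verit) mult_nonneg_nonpos norm_ge_zero)
    hence "c \<le> K * cos (\<theta> + \<phi> x)"
      using elim mult_right_mono order_trans by blast
    thus ?case using \<open>K > 0\<close> by (simp add: S_def field_simps)
  qed
  have "c / K > 0" using \<open>c > 0\<close> \<open>K > 0\<close> by simp
  moreover have "\<phi>\<^sub>m \<in> S"
    using real_essinf_mem_closed[OF \<open>closed S\<close> in_S] assms(7) by simp
  moreover have "\<phi>\<^sub>p \<in> S"
    using real_esssup_mem_closed[OF \<open>closed S\<close> in_S] assms(8) by simp
  ultimately have "cos (\<theta> + \<phi>\<^sub>m) > 0" "cos (\<theta> + \<phi>\<^sub>p) > 0"
    by (auto simp: S_def)
  \<comment> \<open>The closed set is now the interval of phases itself: it contains its own left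
    endpoint, hence is nonempty.\<close>
  moreover have "\<phi>\<^sub>m \<le> \<phi>\<^sub>p"
    using real_essinf_mem_closed[OF closed_atLeastAtMost assms(4)] assms(7) by simp
  ultimately obtain n :: int
    where "2 * of_int n * pi - pi / 2 < \<theta> + \<phi>\<^sub>m" "\<theta> + \<phi>\<^sub>p < 2 * of_int n * pi + pi / 2"
    using cos_pos_same_component[of "\<theta> + \<phi>\<^sub>m" "\<theta> + \<phi>\<^sub>p"] assms(6) by auto
  hence "\<theta> \<in> {2 * of_int n * pi - pi / 2 - \<phi>\<^sub>m <..< 2 * of_int n * pi + pi / 2 - \<phi>\<^sub>p}"
    by auto
  with out show False by blast
qed

end
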